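(* Let $n\in\mathbb{N}$ and let $G=C_2\oplus C_{2n}$. Then the Harborth constant of $G$ satisfies \[ \mathsf{g}(C_2\oplus C_{2n})=\begin{cases} 2n+3 & \text{if $n$ is odd},\\ 2n+2 & \text{if $n$ is even}.\end{cases} \]
   Context: For a finite abelian group $G$ (written additively), $\exp(G)$ denotes its exponent and $C_m$ a cyclic group of order $m$. The Harborth constant $\mathsf{g}(G)$ is the smallest $\ell\in\mathbb{N}$ such that every subset $S\subseteq G$ with $|S|\ge \ell$ contains a subset of exactly $\exp(G)$ elements whose sum is $0$. (If no subset of $G$ has cardinality $\ell$, the condition is vacuously satisfied.) *)

theory Defs
  imports "HOL-Algebra.Algebra"
begin

text \<open>The groups of HOL-Algebra are written multiplicatively: the sum of the elements of a
  finite set \<open>T\<close> in an abelian group \<open>G\<close> is \<open>\<Otimes>\<^bsub>G\<^esub>x\<in>T. x\<close>, and the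
  neutral element is \<open>\<one>\<^bsub>G\<^esub>\<close>.\<close>

definition group_exponent :: "('a, 'b) monoid_scheme \<Rightarrow> nat" where
  "group_exponent G = (LEAST k. 0 < k \<and> (\<forall>x\<in>carrier G. x [^]\<^bsub>G\<^esub> k = \<one>\<^bsub>G\<^esub>))"

text \<open>The Harborth constant of a finite abelian group. The minimum exists, since the condition
  holds vacuously for every \<open>l\<close> larger than the order of the group.\<close>

definition harborth_constant :: "('a, 'b) monoid_scheme \<Rightarrow> nat" where
  "harborth_constant G =
    (LEAST l. \<forall>S. S \<subseteq> carrier G \<and> l \<le> card S \<longrightarrow>
       (\<exists>T\<subseteq>S. card T = group_exponent G \<and> (\<Otimes>\<^bsub>G\<^esub>x\<in>T. x) = \<one>\<^bsub>G\<^esub>))"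

end

theory Submission
  imports Defs
begin

text \<open>The upper bounds come from reflections: if \<open>A\<close> fills more than half of a finite abelian
  group, then \<open>A\<close> meets its image under \<open>x \<mapsto> g - x\<close>, so \<open>g\<close> is a sum of two elements of \<open>A\<close>,
  distinct ones unless the intersection consists of solutions of \<open>2x = g\<close>. With \<open>\<sigma>\<close> the sum of
  all elements of \<open>S\<close>, a zero-sum subset of size \<open>2n\<close> is what remains of \<open>S\<close> after deleting
  elements with sum \<open>\<sigma>\<close>. If \<open>|S| = 2n + 3\<close>, some \<open>z \<in> S\<close> makes \<open>\<sigma> - z\<close> a non-double, as there are
  at most \<open>n\<close> doubles, and \<open>\<sigma> - z\<close> is then a sum of two distinct elements of \<open>S - {z}\<close>. If
  \<open>|S| = 2n + 2\<close>, two elements have to be deleted, and only a \<open>\<sigma>\<close> with first coordinate \<open>0\<close> is in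
  doubt. The number of elements of \<open>S\<close> with first coordinate \<open>1\<close> is then even, so for even \<open>n\<close>
  it is not \<open>n + 1\<close>, and one of the two cosets of \<open>C_2n\<close> contains at least \<open>n + 2\<close> elements of
  \<open>S\<close>; this exceeds the bound by enough to absorb the two solutions of \<open>2x = \<sigma>\<close> in that coset.

  The lower bounds are witnessed by \<open>{0} \<times> C_2n\<close> together with one more point, and, for odd
  \<open>n = 2m + 1\<close>, by \<open>{0} \<times> B \<union> {1} \<times> (-B)\<close> where \<open>B\<close> consists of the residues that reduce to
  \<open>0, \<dots>, m\<close> modulo \<open>n\<close>: this set has sum \<open>0\<close>, but no two distinct elements of it have sum \<open>0\<close>.\<close>

section \<open>Isomorphism invariance\<close>

lemma hom_finprod:
  assumes "comm_group G" "comm_group H" "h \<in> hom G H" "A \<subseteq> carrier G"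
  shows "h (\<Otimes>\<^bsub>G\<^esub>x\<in>A. x) = (\<Otimes>\<^bsub>H\<^esub>x\<in>A. h x)"
proof -
  interpret G: comm_group G by fact
  interpret H: comm_group H by fact
  interpret group_hom G H h
    by unfold_locales fact
  \<comment> \<open>For infinite \<open>A\<close> both products take the default value, the neutral
    element, which \<open>h\<close> preserves.\<close>
  show ?thesis
  proof (cases "finite A")
    case True
    then show ?thesis using assms(4)
    proof (induction A rule: finite_induct)
      case (insert x F)
      then have "x \<in> carrier G" "F \<subseteq> carrier G" by auto
      with insert show ?case
        by (subst G.finprod_insert H.finprod_insert; auto simp: Pi_iff subset_iff)+
    qed simp
  qed simp
qed

lemma group_exponent_iso:
  assumes "group G" "group H" "G \<cong> H"
  shows "group_exponent G = group_exponent H"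
proof -
  \<comment> \<open>Stated for arbitrary groups, so that it can be used along \<open>h\<close> and
    along its inverse.\<close>
  have imp: "\<forall>x\<in>carrier H'. x [^]\<^bsub>H'\<^esub> k = \<one>\<^bsub>H'\<^esub>"
    if gr: "group G'" "group H'" and iso: "h \<in> iso G' H'"
      and k: "\<forall>x\<in>carrier G'. x [^]\<^bsub>G'\<^esub> k = \<one>\<^bsub>G'\<^esub>"
    for G' :: "('x, 'y) monoid_scheme" and H' :: "('z, 'w) monoid_scheme" and h and k :: nat
  proof
    interpret group_hom G' H' h
      using gr iso by (simp add: group_hom_def group_hom_axioms_def iso_def)
    fix y assume "y \<in> carrier H'"
    then obtain x where x: "x \<in> carrier G'" "y = h x"
      using iso by (auto simp: iso_def bij_betw_def)
    then show "y [^]\<^bsub>H'\<^esub> k = \<one>\<^bsub>H'\<^esub>"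
      using k hom_nat_pow[of x k] by simp
  qed
  obtain h where h: "h \<in> iso G H" using assms(3) by (auto simp: is_iso_def)
  obtain h' where h': "h' \<in> iso H G"
    using group.iso_sym[OF assms(1,3)] by (auto simp: is_iso_def)
  have "(\<forall>x\<in>carrier G. x [^]\<^bsub>G\<^esub> k = \<one>\<^bsub>G\<^esub>) \<longleftrightarrow> (\<forall>x\<in>carrier H. x [^]\<^bsub>H\<^esub> k = \<one>\<^bsub>H\<^esub>)"
    for k :: nat
    using imp[OF assms(1,2) h] imp[OF assms(2,1) h'] by blast
  then show ?thesis by (simp add: group_exponent_def)
qed

text \<open>Used in both directions, this makes the two predicates under \<open>LEAST\<close> agree
  at every \<open>l\<close>. The subset size \<open>k\<close> is kept free of either group's
  exponent.\<close>

lemma zero_sum_subset_iso: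
  assumes "comm_group G" "comm_group H" "G \<cong> H"
    and H: "\<forall>S. S \<subseteq> carrier H \<and> l \<le> card S \<longrightarrow>
      (\<exists>T\<subseteq>S. card T = k \<and> (\<Otimes>\<^bsub>H\<^esub>x\<in>T. x) = \<one>\<^bsub>H\<^esub>)"
    and S: "S \<subseteq> carrier G" "l \<le> card S"
  shows "\<exists>T\<subseteq>S. card T = k \<and> (\<Otimes>\<^bsub>G\<^esub>x\<in>T. x) = \<one>\<^bsub>G\<^esub>"
proof -
  interpret G: comm_group G by fact
  interpret H: comm_group H by fact
  obtain h where h: "h \<in> hom G H" and bij: "bij_betw h (carrier G) (carrier H)"
    using assms(3) by (auto simp: is_iso_def iso_def)
  interpret group_hom G H h
    by unfold_locales fact
  have inj: "inj_on h (carrier G)" using bij by (simp add: bij_betw_def)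
  have "h ` S \<subseteq> carrier H" using S(1) by auto
  moreover have "l \<le> card (h ` S)"
    using S inj_on_subset[OF inj S(1)] by (simp add: card_image)
  ultimately obtain T' where T': "T' \<subseteq> h ` S" "card T' = k" "(\<Otimes>\<^bsub>H\<^esub>x\<in>T'. x) = \<one>\<^bsub>H\<^esub>"
    using H by blast
  obtain T where T: "T \<subseteq> S" "T' = h ` T" using T'(1) by (auto simp: subset_image_iff)
  have TG: "T \<subseteq> carrier G" and injT: "inj_on h T"
    using T(1) S(1) inj by (auto intro: inj_on_subset)
  have "h (\<Otimes>\<^bsub>G\<^esub>x\<in>T. x) = (\<Otimes>\<^bsub>H\<^esub>x\<in>T. h x)"
    by (rule hom_finprod) (use assms h TG in auto)
  also have "\<dots> = (\<Otimes>\<^bsub>H\<^esub>x\<in>T'. x)"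
    unfolding T(2) using TG injT by (subst H.finprod_reindex) auto
  also have "\<dots> = h \<one>\<^bsub>G\<^esub>" using T'(3) by simp
  finally have "(\<Otimes>\<^bsub>G\<^esub>x\<in>T. x) = \<one>\<^bsub>G\<^esub>"
    by (rule inj_onD[OF inj]) (use TG in \<open>auto intro!: G.finprod_closed\<close>)
  moreover have "card T = k" using T'(2) T(2) injT by (simp add: card_image)
  ultimately show ?thesis using T(1) by blast
qed

lemma harborth_constant_iso:
  assumes "comm_group G" "comm_group H" "G \<cong> H"
  shows "harborth_constant G = harborth_constant H"
proof -
  have sym: "H \<cong> G" using assms by (simp add: comm_group.axioms group.iso_sym)
  have exp: "group_exponent G = group_exponent H"
    using assms by (intro group_exponent_iso) (auto simp: comm_group.axioms)
  show ?thesis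
    unfolding harborth_constant_def exp
    by (intro arg_cong[where f = Least] ext iffI allI impI; elim conjE)
      (rule zero_sum_subset_iso[OF assms(2,1) sym] zero_sum_subset_iso[OF assms];
        assumption)+
qed

section \<open>Sums of distinct elements\<close>

text \<open>The reflection \<open>r\<close> is injective on \<open>A\<close>, so \<open>A\<close>
  and its image share at least 2|A| - |G| elements. By \<open>big\<close> these outnumber the square
  roots of \<open>g\<close>, so one of them differs from its partner.\<close>

lemma (in comm_group) distinct_pair_mult_eq:
  assumes fin: "finite (carrier G)" and A: "A \<subseteq> carrier G" and g: "g \<in> carrier G"
    and big: "card {x \<in> carrier G. x \<otimes> x = g} + card (carrier G) < 2 * card A"
  obtains x y where "x \<in> A" "y \<in> A" "x \<noteq> y" "x \<otimes> y = g"
proof -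
  define R where "R = {x \<in> carrier G. x \<otimes> x = g}"
  define r where "r = (\<lambda>x. g \<otimes> inv x)"
  have finA: "finite A" using fin A finite_subset by blast
  have "inj_on r A"
    unfolding r_def using A g by (intro inj_onI) (metis inv_closed inv_inv l_cancel subsetD)
  then have cr: "card (r ` A) = card A" by (simp add: card_image)
  have "A \<union> r ` A \<subseteq> carrier G" using A g by (auto simp: r_def)
  then have "card (A \<union> r ` A) \<le> card (carrier G)" using fin card_mono by blast
  then have "card R < card (A \<inter> r ` A)"
    using card_Un_Int[of A "r ` A"] finA cr big by (simp add: R_def)
  moreover have "finite R" using fin by (simp add: R_def)
  ultimately have "\<not> A \<inter> r ` A \<subseteq> R" by (meson card_mono leD)
  then obtain x y where xy: "x \<in> A" "y \<in> A" "x = g \<otimes> inv y" "x \<notin> R" by (auto simp: r_def)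
  then have "x \<in> carrier G" "y \<in> carrier G" using A by auto
  moreover from this have "x \<otimes> y = g" using xy(3) g by (simp add: m_assoc)
  ultimately show thesis using that xy unfolding R_def by blast
qed

lemma (in comm_group) finprod_Diff_eq_one:
  assumes "finite S" "S \<subseteq> carrier G" "D \<subseteq> S" and "(\<Otimes>x\<in>D. x) = (\<Otimes>x\<in>S. x)"
  shows "(\<Otimes>x\<in>S - D. x) = \<one>"
proof -
  have "(\<Otimes>x\<in>(S - D) \<union> D. x) = (\<Otimes>x\<in>S - D. x) \<otimes> (\<Otimes>x\<in>D. x)"
    using assms by (intro finprod_Un_disjoint) (auto intro: finite_subset)
  moreover have "(S - D) \<union> D = S" using assms(3) by auto
  moreover have "(\<Otimes>x\<in>S - D. x) \<in> carrier G" "(\<Otimes>x\<in>S. x) \<in> carrier G"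
    using assms(2) by (auto intro!: finprod_closed)
  ultimately show ?thesis using assms(4) by simp
qed

text \<open>By \<open>few\<close>, the injective image of \<open>S\<close> under z -> g/z does not
  fit into the set of squares. For a z with g/z no square there are no roots to avoid, and the pair
  is sought in S - {z}, whence the -1 in \<open>big\<close>.\<close>

lemma (in comm_group) distinct_triple_mult_eq:
  assumes fin: "finite (carrier G)" and S: "S \<subseteq> carrier G" and g: "g \<in> carrier G"
    and few: "card ((\<lambda>x. x \<otimes> x) ` carrier G) < card S"
    and big: "card (carrier G) < 2 * (card S - 1)"
  obtains x y z where "x \<in> S" "y \<in> S" "z \<in> S" "x \<noteq> y" "x \<noteq> z" "y \<noteq> z" "x \<otimes> (y \<otimes> z) = g"
proof -
  let ?Q = "(\<lambda>x. x \<otimes> x) ` carrier G"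
  have "inj_on (\<lambda>z. g \<otimes> inv z) S"
    using S g by (intro inj_onI) (metis inv_closed inv_inv l_cancel subsetD)
  then have "card ((\<lambda>z. g \<otimes> inv z) ` S) = card S" by (simp add: card_image)
  with few fin have "\<not> (\<lambda>z. g \<otimes> inv z) ` S \<subseteq> ?Q"
    by (metis card_mono finite_imageI leD)
  then obtain z where z: "z \<in> S" "g \<otimes> inv z \<notin> ?Q" by blast
  then have zG: "z \<in> carrier G" using S by blast
  have empty: "{x \<in> carrier G. x \<otimes> x = g \<otimes> inv z} = {}" using z(2) by force
  have "card {x \<in> carrier G. x \<otimes> x = g \<otimes> inv z} + card (carrier G) < 2 * card (S - {z})"
    unfolding empty using big z(1) by simp
  moreover have "S - {z} \<subseteq> carrier G" "g \<otimes> inv z \<in> carrier G" using S g zG by auto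
  ultimately obtain x y
    where xy: "x \<in> S - {z}" "y \<in> S - {z}" "x \<noteq> y" "x \<otimes> y = g \<otimes> inv z"
    using distinct_pair_mult_eq[OF fin, of "S - {z}"] by blast
  have "x \<in> carrier G" "y \<in> carrier G" using xy S by auto
  then have "x \<otimes> (y \<otimes> z) = g"
    using xy(4) zG g by (simp flip: m_assoc) (simp add: m_assoc)
  with xy z that show thesis by blast
qed

section \<open>Products of two cyclic groups\<close>

lemma comm_group_DirProd:
  assumes "comm_group G" "comm_group H"
  shows "comm_group (G \<times>\<times> H)"
proof -
  interpret G: comm_group G by fact
  interpret H: comm_group H by fact
  interpret group "G \<times>\<times> H" by (rule DirProd_group) unfold_locales
  show ?thesis
    by (rule group_comm_groupI) (auto simp: DirProd_def G.m_comm H.m_comm)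
qed

lemma comm_group_integer_mod_prod [simp]:
  "comm_group (integer_mod_group a \<times>\<times> integer_mod_group b)"
  by (simp add: comm_group_DirProd)

lemma finprod_integer_mod_prod:
  assumes "finite T" "T \<subseteq> carrier (integer_mod_group a \<times>\<times> integer_mod_group b)"
  shows "(\<Otimes>\<^bsub>integer_mod_group a \<times>\<times> integer_mod_group b\<^esub>x\<in>T. x) =
    (sum fst T mod int a, sum snd T mod int b)"
proof -
  interpret comm_group "integer_mod_group a \<times>\<times> integer_mod_group b" by simp
  show ?thesis
    using assms
  proof (induction T rule: finite_induct)
    case (insert x F)
    let ?H = "integer_mod_group a \<times>\<times> integer_mod_group b"
    have "(\<Otimes>\<^bsub>?H\<^esub>x\<in>insert x F. x) = x \<otimes>\<^bsub>?H\<^esub> (\<Otimes>\<^bsub>?H\<^esub>x\<in>F. x)"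
      by (rule finprod_insert) (use insert in auto)
    also have "(\<Otimes>\<^bsub>?H\<^esub>x\<in>F. x) = (sum fst F mod int a, sum snd F mod int b)"
      using insert by auto
    finally show ?case
      using insert.hyps by (simp add: DirProd_def split_beta mod_add_right_eq)
  qed simp
qed

lemma group_exponent_C2_C2n:
  assumes "n \<ge> 1"
  shows "group_exponent (integer_mod_group 2 \<times>\<times> integer_mod_group (2 * n)) = 2 * n"
proof -
  let ?H = "integer_mod_group 2 \<times>\<times> integer_mod_group (2 * n)"
  have pow: "x [^]\<^bsub>?H\<^esub> k = (int k * fst x mod 2, int k * snd x mod int (2 * n))" for x and k :: nat
  proof (induction k)
    case (Suc k)
    then show ?case
      by (simp add: DirProd_def split_beta mod_add_right_eq algebra_simps)
  qed simp
  \<comment> \<open>An element of order 2n, which bounds the exponent from below.\<close>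
  have "(0, 1) \<in> carrier ?H" using assms by (simp add: carrier_integer_mod_group)
  show ?thesis
    unfolding group_exponent_def
  proof (rule Least_equality)
    show "0 < 2 * n \<and> (\<forall>x\<in>carrier ?H. x [^]\<^bsub>?H\<^esub> (2 * n) = \<one>\<^bsub>?H\<^esub>)"
      using assms by (auto simp: pow)
  next
    fix k :: nat assume k: "0 < k \<and> (\<forall>x\<in>carrier ?H. x [^]\<^bsub>?H\<^esub> k = \<one>\<^bsub>?H\<^esub>)"
    with \<open>(0, 1) \<in> carrier ?H\<close> have "int k mod int (2 * n) = 0"
      by (fastforce simp: pow)
    then have "2 * n dvd k" by (simp only: mod_eq_0_iff_dvd int_dvd_int_iff)
    then show "2 * n \<le> k" using k by (simp add: dvd_imp_le)
  qed
qed

text \<open>Doubling modulo 2n sees y only modulo n: the residue of y modulo n must be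
  \<open>t div 2\<close>, which leaves two candidates below 2n.\<close>

lemma card_roots_double_mod:
  fixes t :: int
  assumes "n \<ge> 1"
  shows "card {y \<in> carrier (integer_mod_group (2 * n)). y \<otimes>\<^bsub>integer_mod_group (2 * n)\<^esub> y = t} \<le> 2"
proof -
  let ?R = "{y \<in> carrier (integer_mod_group (2 * n)). y \<otimes>\<^bsub>integer_mod_group (2 * n)\<^esub> y = t}"
  have "?R \<subseteq> {t div 2, t div 2 + int n}"
  proof
    fix y assume "y \<in> ?R"
    then have y: "0 \<le> y" "y < 2 * int n" "(2 * y) mod (2 * int n) = t"
      using assms by (auto simp: carrier_integer_mod_group simp flip: mult_2)
    have "t = 2 * (y mod int n)" by (simp only: y(3)[symmetric] mult_mod_right)
    then have "t div 2 = y mod int n" by simp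
    moreover have "y mod int n = (if y < int n then y else y - int n)"
      using y mod_pos_pos_trivial[of "y - int n" "int n"] by auto
    ultimately show "y \<in> {t div 2, t div 2 + int n}" by (auto split: if_splits)
  qed
  then have "card ?R \<le> card {t div 2, t div 2 + int n}" by (intro card_mono) auto
  also have "\<dots> \<le> 2" by (simp add: card_insert_if)
  finally show ?thesis .
qed

section \<open>The group C_2 + C_2n in coordinates\<close>

locale C2_C2n =
  fixes n :: nat and H
  assumes n: "n \<ge> 1" and H_def: "H = integer_mod_group 2 \<times>\<times> integer_mod_group (2 * n)"
begin

sublocale comm_group H
  by (simp add: H_def)

lemma carrier_H: "carrier H = {0..<2} \<times> {0..<2 * int n}"
  using n by (auto simp: H_def carrier_integer_mod_group)

lemma finite_carrier: "finite (carrier H)"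
  by (simp add: carrier_H)

lemma card_carrier: "card (carrier H) = 4 * n"
  by (simp add: carrier_H nat_mult_distrib)

lemma mult_H: "x \<otimes>\<^bsub>H\<^esub> y = ((fst x + fst y) mod 2, (snd x + snd y) mod (2 * int n))"
  by (simp add: H_def DirProd_def split_beta)

lemma one_H: "\<one>\<^bsub>H\<^esub> = (0, 0)"
  by (simp add: H_def)

lemma finprod_H:
  assumes "T \<subseteq> carrier H"
  shows "(\<Otimes>\<^bsub>H\<^esub>x\<in>T. x) = (sum fst T mod 2, sum snd T mod (2 * int n))"
proof -
  have "finite T" using assms finite_carrier finite_subset by blast
  with assms show ?thesis
    using finprod_integer_mod_prod[of T 2 "2 * n"] unfolding H_def by simp
qed

text \<open>A double has first coordinate 0, and its second coordinate is twice a residue modulo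
  n.\<close>

lemma card_squares: "card ((\<lambda>x. x \<otimes>\<^bsub>H\<^esub> x) ` carrier H) \<le> n"
proof -
  have "(\<lambda>x. x \<otimes>\<^bsub>H\<^esub> x) ` carrier H \<subseteq> (\<lambda>k. (0, 2 * k)) ` {0..<int n}"
  proof
    fix w assume "w \<in> (\<lambda>x. x \<otimes>\<^bsub>H\<^esub> x) ` carrier H"
    then obtain x where "w = x \<otimes>\<^bsub>H\<^esub> x" by auto
    then have "w = (0, 2 * (snd x mod int n))"
      by (simp only: mult_H mult_2[symmetric] mod_mult_self1_is_0 mult_mod_right)
    then show "w \<in> (\<lambda>k. (0, 2 * k)) ` {0..<int n}" using n by auto
  qed
  then have "card ((\<lambda>x. x \<otimes>\<^bsub>H\<^esub> x) ` carrier H) \<le> card ((\<lambda>k. (0::int, 2 * k)) ` {0..<int n})"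
    by (intro card_mono) auto
  also have "\<dots> \<le> n" using card_image_le[of "{0..<int n}"] by fastforce
  finally show ?thesis .
qed

section \<open>Upper bounds\<close>

lemma upper_bound_2n_plus_3:
  assumes S: "S \<subseteq> carrier H" and card: "card S = 2 * n + 3"
  shows "\<exists>T\<subseteq>S. card T = 2 * n \<and> (\<Otimes>\<^bsub>H\<^esub>x\<in>T. x) = \<one>\<^bsub>H\<^esub>"
proof -
  have fin: "finite S" using S finite_carrier finite_subset by blast
  have "(\<Otimes>\<^bsub>H\<^esub>x\<in>S. x) \<in> carrier H" using S by (auto intro!: finprod_closed)
  moreover have "card ((\<lambda>x. x \<otimes>\<^bsub>H\<^esub> x) ` carrier H) < card S"
    using card_squares card by linarith
  moreover have "card (carrier H) < 2 * (card S - 1)"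
    using card_carrier card by simp
  ultimately obtain x y z where xyz: "x \<in> S" "y \<in> S" "z \<in> S" "x \<noteq> y" "x \<noteq> z" "y \<noteq> z"
    and eq: "x \<otimes>\<^bsub>H\<^esub> (y \<otimes>\<^bsub>H\<^esub> z) = (\<Otimes>\<^bsub>H\<^esub>x\<in>S. x)"
    by (rule distinct_triple_mult_eq[OF finite_carrier S])
  have "x \<in> carrier H" "y \<in> carrier H" "z \<in> carrier H" using xyz S by auto
  then have "(\<Otimes>\<^bsub>H\<^esub>w\<in>{x, y, z}. w) = (\<Otimes>\<^bsub>H\<^esub>x\<in>S. x)"
    using eq xyz by simp
  then have "(\<Otimes>\<^bsub>H\<^esub>w\<in>S - {x, y, z}. w) = \<one>\<^bsub>H\<^esub>"
    using fin S xyz by (intro finprod_Diff_eq_one) auto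
  moreover have "card (S - {x, y, z}) = 2 * n"
    using xyz card by (subst card_Diff_subset) auto
  ultimately show ?thesis by blast
qed

text \<open>Within one coset the reflection count is 2 + 2n < 2(n + 2). In all of \<open>H\<close>
  there may be four roots, and 4 + 4n < 2(2n + 2) just fails for a set of 2n + 2 elements; hence the
  passage to a coset.\<close>

lemma distinct_pair_in_fibre:
  assumes S: "S \<subseteq> carrier H" and i: "n + 2 \<le> card {y. (i, y) \<in> S}"
    and t: "t \<in> {0..<2 * int n}"
  obtains y z where "(i, y) \<in> S" "(i, z) \<in> S" "y \<noteq> z" "(y + z) mod (2 * int n) = t"
proof -
  let ?Z = "integer_mod_group (2 * n)"
  interpret Z: comm_group ?Z by simp
  have carrier: "carrier ?Z = {0..<2 * int n}" using n by (simp add: carrier_integer_mod_group)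
  have "card {y \<in> carrier ?Z. y \<otimes>\<^bsub>?Z\<^esub> y = t} + card (carrier ?Z) < 2 * card {y. (i, y) \<in> S}"
    using card_roots_double_mod[OF n, of t] i carrier by simp
  moreover have "{y. (i, y) \<in> S} \<subseteq> carrier ?Z" using S by (auto simp: carrier carrier_H)
  ultimately obtain y z where "y \<in> {y. (i, y) \<in> S}" "z \<in> {y. (i, y) \<in> S}" "y \<noteq> z"
    "y \<otimes>\<^bsub>?Z\<^esub> z = t"
    using t Z.distinct_pair_mult_eq[of "{y. (i, y) \<in> S}" t] by (auto simp: carrier)
  then show thesis using that by simp
qed

lemma upper_bound_2n_plus_2:
  assumes "even n" and S: "S \<subseteq> carrier H" and card: "card S = 2 * n + 2"
  shows "\<exists>T\<subseteq>S. card T = 2 * n \<and> (\<Otimes>\<^bsub>H\<^esub>x\<in>T. x) = \<one>\<^bsub>H\<^esub>"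
proof -
  have fin: "finite S" using S finite_carrier finite_subset by blast
  define g where "g = (\<Otimes>\<^bsub>H\<^esub>x\<in>S. x)"
  have gH: "g \<in> carrier H" unfolding g_def using S by (auto intro!: finprod_closed)
  have "\<exists>x\<in>S. \<exists>y\<in>S. x \<noteq> y \<and> x \<otimes>\<^bsub>H\<^esub> y = g"
  proof (cases "fst g = 0")
    case False
    \<comment> \<open>Doubles have first coordinate 0, so there are no roots and 4n < 2(2n + 2)
      suffices.\<close>
    then have empty: "{x \<in> carrier H. x \<otimes>\<^bsub>H\<^esub> x = g} = {}" by (auto simp: mult_H)
    have "card {x \<in> carrier H. x \<otimes>\<^bsub>H\<^esub> x = g} + card (carrier H) < 2 * card S"
      unfolding empty using card card_carrier by simp
    from distinct_pair_mult_eq[OF finite_carrier S gH this] show ?thesis by blast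
  next
    case True
    define A where "A = (\<lambda>i. {y. (i, y) \<in> S})"
    have S_eq: "S = Pair 0 ` A 0 \<union> Pair 1 ` A 1"
    proof
      show "S \<subseteq> Pair 0 ` A 0 \<union> Pair 1 ` A 1"
      proof
        fix x assume "x \<in> S"
        moreover from this have "fst x = 0 \<or> fst x = 1" using S by (auto simp: carrier_H)
        ultimately show "x \<in> Pair 0 ` A 0 \<union> Pair 1 ` A 1" by (cases x) (auto simp: A_def)
      qed
    qed (auto simp: A_def)
    have "A i \<subseteq> snd ` S" for i
    proof
      fix y assume "y \<in> A i"
      then show "y \<in> snd ` S" by (intro image_eqI[of _ _ "(i, y)"]) (auto simp: A_def)
    qed
    then have finA: "finite (A i)" for i
      using fin by (meson finite_imageI finite_subset)
    have disj: "Pair 0 ` A 0 \<inter> Pair 1 ` A 1 = ({} :: (int \<times> int) set)" by auto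
    have "card S = card (A 0) + card (A 1)"
      by (subst S_eq, subst card_Un_disjoint) (use finA disj in \<open>auto simp: card_image inj_on_def\<close>)
    moreover have "sum fst S = int (card (A 1))"
      by (subst S_eq, subst sum.union_disjoint)
        (use finA disj in \<open>auto simp: sum.reindex inj_on_def\<close>)
    then have "even (card (A 1))"
      using True finprod_H[OF S] by (auto simp: g_def)
    \<comment> \<open>The two sizes add up to 2n + 2. They cannot both be n + 1, which is
      odd.\<close>
    ultimately have "n + 2 \<le> card (A 0) \<or> n + 2 \<le> card (A 1)"
      using card \<open>even n\<close> by presburger
    then obtain i :: int where i: "n + 2 \<le> card {y. (i, y) \<in> S}"
      unfolding A_def by blast
    have "snd g \<in> {0..<2 * int n}" using gH by (auto simp: carrier_H)
    from distinct_pair_in_fibre[OF S i this]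
    obtain y z where yz: "(i, y) \<in> S" "(i, z) \<in> S" "y \<noteq> z" "(y + z) mod (2 * int n) = snd g" .
    then have "(i, y) \<otimes>\<^bsub>H\<^esub> (i, z) = g"
      using True by (simp add: mult_H prod_eq_iff)
    with yz show ?thesis by blast
  qed
  then obtain x y where xy: "x \<in> S" "y \<in> S" "x \<noteq> y" "x \<otimes>\<^bsub>H\<^esub> y = g" by blast
  have "x \<in> carrier H" "y \<in> carrier H" using xy S by auto
  then have "(\<Otimes>\<^bsub>H\<^esub>w\<in>{x, y}. w) = (\<Otimes>\<^bsub>H\<^esub>x\<in>S. x)"
    using xy by (simp add: g_def)
  then have "(\<Otimes>\<^bsub>H\<^esub>w\<in>S - {x, y}. w) = \<one>\<^bsub>H\<^esub>"
    using fin S xy by (intro finprod_Diff_eq_one) auto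
  moreover have "card (S - {x, y}) = 2 * n"
    using xy card by (subst card_Diff_subset) auto
  ultimately show ?thesis by blast
qed

section \<open>Lower bounds\<close>

lemma lower_bound_2n_plus_2:
  obtains S where "S \<subseteq> carrier H" "card S = 2 * n + 1"
    "\<And>T. T \<subseteq> S \<Longrightarrow> card T = 2 * n \<Longrightarrow> (\<Otimes>\<^bsub>H\<^esub>x\<in>T. x) \<noteq> \<one>\<^bsub>H\<^esub>"
proof
  define F where "F = Pair (0::int) ` {0..<2 * int n}"
  let ?S = "insert (1, 0) F"
  have cardF: "card F = 2 * n" and finF: "finite F"
    by (auto simp: F_def card_image inj_on_def)
  show S: "?S \<subseteq> carrier H" using n by (auto simp: F_def carrier_H)
  show "card ?S = 2 * n + 1"
    using cardF finF by (subst card_insert_disjoint) (auto simp: F_def)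
  fix T assume T: "T \<subseteq> ?S" "card T = 2 * n"
  show "(\<Otimes>\<^bsub>H\<^esub>x\<in>T. x) \<noteq> \<one>\<^bsub>H\<^esub>"
  proof
    assume "(\<Otimes>\<^bsub>H\<^esub>x\<in>T. x) = \<one>\<^bsub>H\<^esub>"
    then have zero: "sum fst T mod 2 = 0" "sum snd T mod (2 * int n) = 0"
      using finprod_H[of T] T(1) S by (auto simp: one_H)
    have finT: "finite T" using finite_subset[OF T(1)] finF by simp
    show False
    proof (cases "(1, 0) \<in> T")
      \<comment> \<open>The extra point alone contributes 1 to the first coordinate.\<close>
      case True
      have "\<forall>x\<in>F. fst x = 0" by (simp add: F_def)
      then have "sum fst (T - {(1, 0)}) = 0"
        using T(1) by (intro sum.neutral) blast
      then have "sum fst T = 1" using True finT by (simp add: sum.remove)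
      then show False using zero by simp
    next
      case False
      then have "T = F" using T finF cardF by (intro card_subset_eq) auto
      \<comment> \<open>Without the extra point, \<open>T\<close> is the whole coset
        \<open>F\<close>. Its second coordinates sum to n(2n - 1), an odd multiple of n and so
        nonzero modulo 2n.\<close>
      have gauss: "2 * (\<Sum>k\<in>{0..<int m}. k) = int m * (int m - 1)" for m
      proof (induction m)
        case (Suc m)
        have "{0..<int (Suc m)} = insert (int m) {0..<int m}" by auto
        with Suc show ?case by (simp add: algebra_simps)
      qed simp
      have "sum snd T = (\<Sum>k\<in>{0..<int (2 * n)}. k)"
        unfolding \<open>T = F\<close> F_def by (subst sum.reindex) (auto simp: inj_on_def)
      then have "sum snd T = int n * (2 * int n - 1)"
        using gauss[of "2 * n"] by simp
      then have "2 * int n dvd int n * (2 * int n - 1)" using zero by auto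
      then have "even (2 * int n - 1)" using n by (simp add: mult.commute[of 2])
      then show False by simp
    qed
  qed
qed

lemma lower_bound_2n_plus_3:
  assumes "odd n"
  obtains S where "S \<subseteq> carrier H" "card S = 2 * n + 2"
    "\<And>T. T \<subseteq> S \<Longrightarrow> card T = 2 * n \<Longrightarrow> (\<Otimes>\<^bsub>H\<^esub>x\<in>T. x) \<noteq> \<one>\<^bsub>H\<^esub>"
proof
  define m where "m = n div 2"
  then have m: "n = 2 * m + 1" using assms by simp
  define B where "B = {0..int m} \<union> {int n..int n + int m}"
  define neg where "neg = (\<lambda>y. (- y) mod (2 * int n))"
  define S where "S = Pair (0::int) ` B \<union> Pair 1 ` neg ` B"
  have finB: "finite B" by (simp add: B_def)
  have cardB: "card B = n + 1"
    unfolding B_def by (subst card_Un_disjoint) (auto simp: m)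
  have Bbd: "0 \<le> y" "y < 2 * int n" if "y \<in> B" for y
    using that by (auto simp: B_def m)
  \<comment> \<open>The sum lies in [0, 4n), so it is 0 or 2n. Sum 0 forces u = v = 0. Sum 2n forces
    both into the upper interval, since n + 2m = 2n - 1, and there u = v = n.\<close>
  have Bpair: "u = v" if uv: "u \<in> B" "v \<in> B" and "2 * int n dvd u + v" for u v
  proof -
    obtain k where k: "u + v = 2 * int n * k" using \<open>2 * int n dvd u + v\<close> by blast
    have "2 * int n * 0 \<le> 2 * int n * k" "2 * int n * k < 2 * int n * 2"
      using Bbd[OF uv(1)] Bbd[OF uv(2)] unfolding k[symmetric] by auto
    then have "0 \<le> k" "k < 2" using n by (simp_all only: mult_less_cancel_left mult_le_cancel_left)
    then have "k = 0 \<or> k = 1" by auto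
    then have "u + v = 0 \<or> u + v = 2 * int n" using k by auto
    then show ?thesis using uv by (auto simp: B_def m)
  qed
  have injneg: "inj_on neg B"
  proof (rule inj_onI)
    fix u v assume uv: "u \<in> B" "v \<in> B" "neg u = neg v"
    then have "u mod (2 * int n) = v mod (2 * int n)"
      unfolding neg_def by (metis mod_minus_cong minus_minus)
    then show "u = v" using uv Bbd by (simp add: mod_pos_pos_trivial)
  qed
  have disj: "Pair (0::int) ` B \<inter> Pair 1 ` neg ` B = {}" by auto
  have finS: "finite S" using finB by (simp add: S_def)
  show SH: "S \<subseteq> carrier H" using n Bbd by (auto simp: S_def carrier_H neg_def)
  show cardS: "card S = 2 * n + 2"
    unfolding S_def using finB cardB injneg disj
    by (subst card_Un_disjoint) (auto simp: card_image inj_on_def)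
  \<comment> \<open>This is where odd n enters: n + 1 points in the coset with first coordinate 1
    give an even sum.\<close>
  have "sum fst S = int (n + 1)"
    unfolding S_def using finB cardB injneg disj
    by (subst sum.union_disjoint) (auto simp: sum.reindex card_image inj_on_def)
  then have fstS: "even (sum fst S)" using assms by simp
  have "sum snd S = sum (\<lambda>y. y) B + sum neg B"
    unfolding S_def using finB injneg disj
    by (subst sum.union_disjoint) (auto simp: sum.reindex inj_on_def)
  also have "\<dots> = (\<Sum>y\<in>B. y + neg y)" by (simp add: sum.distrib)
  also have "2 * int n dvd \<dots>"
  proof (rule dvd_sum)
    fix y
    have "(y + neg y) mod (2 * int n) = 0" by (simp add: neg_def mod_add_right_eq)
    then show "2 * int n dvd y + neg y" by (rule mod_0_imp_dvd)
  qed
  finally have sndS: "2 * int n dvd sum snd S" .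
  fix T assume T: "T \<subseteq> S" "card T = 2 * n"
  show "(\<Otimes>\<^bsub>H\<^esub>x\<in>T. x) \<noteq> \<one>\<^bsub>H\<^esub>"
  proof
    assume "(\<Otimes>\<^bsub>H\<^esub>x\<in>T. x) = \<one>\<^bsub>H\<^esub>"
    then have zero: "even (sum fst T)" "2 * int n dvd sum snd T"
      using finprod_H[of T] T(1) SH by (auto simp: one_H)
    \<comment> \<open>As \<open>S\<close> has sum zero, a zero-sum \<open>T\<close> would leave two
      distinct elements of \<open>S\<close> with sum zero.\<close>
    have "card (S - T) = 2" using T cardS finS by (simp add: card_Diff_subset finite_subset)
    then obtain x y where xy: "S - T = {x, y}" "x \<noteq> y" by (auto simp: card_2_iff)
    have "sum f S = sum f T + (f x + f y)" for f :: "int \<times> int \<Rightarrow> int"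
      using sum.subset_diff[OF T(1) finS, of f] xy by simp
    then have ev: "even (fst x + fst y)" and dv: "2 * int n dvd snd x + snd y"
      using zero fstS sndS by (metis dvd_add_right_iff)+
    have "x \<in> S" "y \<in> S" using xy by auto
    \<comment> \<open>Equal parity of the first coordinates puts both elements into the same
      coset.\<close>
    then consider u v where "u \<in> B" "v \<in> B" "x = (0, u)" "y = (0, v)"
      | u v where "u \<in> B" "v \<in> B" "x = (1, neg u)" "y = (1, neg v)"
      using ev by (auto simp: S_def)
    then show False
    proof cases
      case 1
      then show False using Bpair dv xy(2) by auto
    next
      case 2
      have "(neg u + neg v) mod (2 * int n) = (- (u + v)) mod (2 * int n)"
        unfolding neg_def by (simp add: mod_add_eq)
      then have "2 * int n dvd u + v" using dv 2
        by (metis dvd_eq_mod_eq_0 dvd_minus_iff snd_conv)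
      then show False using Bpair 2 xy(2) by auto
    qed
  qed
qed

section \<open>The value of the constant\<close>

lemma harborth_constant_eqI:
  assumes upper: "\<And>S. S \<subseteq> carrier H \<Longrightarrow> card S = Suc l \<Longrightarrow>
      \<exists>T\<subseteq>S. card T = 2 * n \<and> (\<Otimes>\<^bsub>H\<^esub>x\<in>T. x) = \<one>\<^bsub>H\<^esub>"
    and lower: "S0 \<subseteq> carrier H" "card S0 = l"
      "\<And>T. T \<subseteq> S0 \<Longrightarrow> card T = 2 * n \<Longrightarrow> (\<Otimes>\<^bsub>H\<^esub>x\<in>T. x) \<noteq> \<one>\<^bsub>H\<^esub>"
  shows "harborth_constant H = Suc l"
proof -
  have "group_exponent H = 2 * n" using group_exponent_C2_C2n[OF n] by (simp add: H_def)
  then show ?thesis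
    unfolding harborth_constant_def
  proof (intro Least_equality allI impI, elim conjE)
    fix S assume "S \<subseteq> carrier H" "Suc l \<le> card S"
    \<comment> \<open>Larger sets reduce to size exactly \<open>Suc l\<close>, the only size that
      \<open>upper\<close> covers.\<close>
    then obtain S' where "S' \<subseteq> S" "card S' = Suc l"
      by (meson obtain_subset_with_card_n)
    then show "\<exists>T\<subseteq>S. card T = group_exponent H \<and> (\<Otimes>\<^bsub>H\<^esub>x\<in>T. x) = \<one>\<^bsub>H\<^esub>"
      using upper[of S'] \<open>S \<subseteq> carrier H\<close> \<open>group_exponent H = 2 * n\<close> by (metis subset_trans)
  next
    fix k
    assume "\<forall>S. S \<subseteq> carrier H \<and> k \<le> card S \<longrightarrow>
      (\<exists>T\<subseteq>S. card T = group_exponent H \<and> (\<Otimes>\<^bsub>H\<^esub>x\<in>T. x) = \<one>\<^bsub>H\<^esub>)"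
    \<comment> \<open>The single set \<open>S0\<close> of size \<open>l\<close> refutes every
      threshold up to \<open>l\<close>.\<close>
    then have "\<not> k \<le> l" using lower \<open>group_exponent H = 2 * n\<close> by metis
    then show "Suc l \<le> k" by simp
  qed
qed

lemma harborth_constant_H:
  "harborth_constant H = (if odd n then 2 * n + 3 else 2 * n + 2)"
proof (cases "odd n")
  case True
  obtain S where "S \<subseteq> carrier H" "card S = 2 * n + 2"
    "\<And>T. T \<subseteq> S \<Longrightarrow> card T = 2 * n \<Longrightarrow> (\<Otimes>\<^bsub>H\<^esub>x\<in>T. x) \<noteq> \<one>\<^bsub>H\<^esub>"
    using lower_bound_2n_plus_3[OF True] by metis
  then have "harborth_constant H = Suc (2 * n + 2)"
    using upper_bound_2n_plus_3 by (intro harborth_constant_eqI) auto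
  with True show ?thesis by simp
next
  case False
  obtain S where "S \<subseteq> carrier H" "card S = 2 * n + 1"
    "\<And>T. T \<subseteq> S \<Longrightarrow> card T = 2 * n \<Longrightarrow> (\<Otimes>\<^bsub>H\<^esub>x\<in>T. x) \<noteq> \<one>\<^bsub>H\<^esub>"
    using lower_bound_2n_plus_2 by metis
  then have "harborth_constant H = Suc (2 * n + 1)"
    using upper_bound_2n_plus_2 False by (intro harborth_constant_eqI) auto
  with False show ?thesis by simp
qed

end

theorem theorem1p1:
  fixes G :: "('a, 'b) monoid_scheme" and n :: nat
  assumes "n \<ge> 1"
    and "comm_group G"
    and "G \<cong> integer_mod_group 2 \<times>\<times> integer_mod_group (2 * n)"
  shows "harborth_constant G = (if odd n then 2 * n + 3 else 2 * n + 2)"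
proof -
  interpret C2_C2n n "integer_mod_group 2 \<times>\<times> integer_mod_group (2 * n)"
    using assms(1) by unfold_locales auto
  show ?thesis
    using harborth_constant_iso[OF assms(2) _ assms(3)] harborth_constant_H by simp
qed

end
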